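(* Let $(X,d)$ be a complete metric space, let $S\subset X$ be a nonempty closed set, let $Y$ be a real vector space quasi-ordered by a convex cone $D\subset Y$, and let $f:X\to Y$ be a map. Let $H\subset D$ be a nonempty $D$-convex set such that $0\notin \mathrm{vcl}(H+D)$. Let $\epsilon>0$ and let $x_0\in S$ be an $\epsilon$-efficient solution in the sense of Németh with respect to $H$ of the problem $\mathrm{Min}\{f(x): x\in S\}$, i.e. $(f(S)-f(x_0))\cap(-\epsilon H-D)=\emptyset$. Let $\gamma>0$, for $x\in S$ put $$S_\gamma(x)=\{z\in S:\ f(x)\in f(z)+\gamma d(x,z)H+D\},$$ and assume that for every $x\in S_\gamma(x_0)$ the set $S_\gamma(x)$ is dynamically closed. Then there exists $\hat{x}\in S$ such that (a) $f(x_0)\in f(\hat{x})+\gamma d(x_0,\hat{x})H+D$; (b) $d(x_0,\hat{x})H\cap(\epsilon/\gamma)\,(\mathrm{cone}(C_H)\setminus C_H)\neq\emptyset$, where $C_H=H+D$; (c) for all $x\in S\setminus\{\hat{x}\}$, $f(\hat{x})\notin f(x)+\gamma d(\hat{x},x)H+D$.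
   Context: A convex cone is a nonempty set $D\subset Y$ with $D+D\subset D$ and $\alpha D\subset D$ for all $\alpha\ge0$ (so $0\in D$). For $A,B\subset Y$ and $\alpha\in\mathbb{R}$, $A+B=\{a+b: a\in A,b\in B\}$ and $\alpha A=\{\alpha a:a\in A\}$. A set $H\subset Y$ is $D$-convex if $H+D$ is convex. For $A\subset Y$, $\mathrm{cone}(A)=\{\alpha a:\alpha\ge0,\ a\in A\}$ is the cone generated by $A$. The vector closure of $A\subset Y$ is $$\mathrm{vcl}(A)=\{y\in Y:\ \exists v\in Y,\ \exists\lambda_n\ge0,\ \lambda_n\to0 \text{ such that } y+\lambda_n v\in A\ \forall n\in\mathbb{N}\}.$$ $f(S)=\{f(x):x\in S\}$. For a set-valued map $x\mapsto S_\gamma(x)$, the set $S_\gamma(x)$ is called dynamically closed if, whenever $(x_n)\subset S_\gamma(x)$ is a sequence with $S_\gamma(x_{n+1})\subset S_\gamma(x_n)\subset S_\gamma(x)$ for all $n$ and $x_n\to\bar{x}$, then $\bar{x}\in S_\gamma(x)$. *)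

theory Defs
  imports "HOL-Analysis.Analysis"
begin

text \<open>
  Sums of sets are the Minkowski sums of \<^theory>\<open>HOL-Library.Set_Algebras\<close>, with
  \<open>y +o A\<close> the translate \<open>y + A\<close>, and \<open>(*\<^sub>R) a ` A\<close> is the scaled set \<open>a A\<close>.
  The binary minus on sets is always set difference, so \<open>- a A - B\<close> in the
  algebraic sense is written \<open>(*\<^sub>R) (- a) ` A + uminus ` B\<close>.

  Convex cones are \<^const>\<open>convex_cone\<close>, which by the following lemma are exactly the
  nonempty sets \<open>D\<close> with \<open>D + D \<subseteq> D\<close> and \<open>a D \<subseteq> D\<close> for all \<open>a \<ge> 0\<close>.
  The cone generated by \<open>A\<close> is \<open>conic hull A\<close>, which by \<open>conic_hull_explicit\<close> is
  \<open>{a *\<^sub>R y | a y. 0 \<le> a \<and> y \<in> A}\<close>.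
\<close>

lemma convex_cone_iff_plus:
  fixes D :: "'y::real_vector set"
  shows "convex_cone D \<longleftrightarrow> D \<noteq> {} \<and> D + D \<subseteq> D \<and> (\<forall>a\<ge>0. (*\<^sub>R) a ` D \<subseteq> D)"
proof
  assume D: "convex_cone D"
  then have "x + y \<in> D" if "x \<in> D" "y \<in> D" for x y
    using that by (rule convex_cone_add)
  then show "D \<noteq> {} \<and> D + D \<subseteq> D \<and> (\<forall>a\<ge>0. (*\<^sub>R) a ` D \<subseteq> D)"
    using D by (auto simp: convex_cone_def conic_def set_plus_def)
next
  assume D: "D \<noteq> {} \<and> D + D \<subseteq> D \<and> (\<forall>a\<ge>0. (*\<^sub>R) a ` D \<subseteq> D)"
  then have sc: "a *\<^sub>R x \<in> D" if "x \<in> D" "0 \<le> a" for a x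
    using that by blast
  from D have add: "x + y \<in> D" if "x \<in> D" "y \<in> D" for x y
    using that by blast
  have "convex D"
    unfolding convex_def using sc add by blast
  then show "convex_cone D"
    using D sc by (auto simp: convex_cone_def conic_def)
qed

definition D_convex :: "'y::real_vector set \<Rightarrow> 'y set \<Rightarrow> bool"
  where "D_convex D H \<longleftrightarrow> convex (H + D)"

definition vcl :: "'y::real_vector set \<Rightarrow> 'y set"
  where "vcl A = {y. \<exists>v. \<exists>l :: nat \<Rightarrow> real.
    (\<forall>n. 0 \<le> l n) \<and> l \<longlonglongrightarrow> 0 \<and> (\<forall>n. y + l n *\<^sub>R v \<in> A)}"

text \<open>\<open>\<epsilon>\<close>-efficiency in the sense of Nemeth with respect to \<open>H\<close>, for the problem
  \<open>Min {f x | x \<in> S}\<close> in the quasi-order \<open>y \<le> z \<longleftrightarrow> z - y \<in> D\<close>.\<close>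

definition nemeth_efficient ::
    "'y::real_vector set \<Rightarrow> 'y set \<Rightarrow> real \<Rightarrow> ('x \<Rightarrow> 'y) \<Rightarrow> 'x set \<Rightarrow> 'x \<Rightarrow> bool"
  where "nemeth_efficient D H \<epsilon> f S x0 \<longleftrightarrow>
    x0 \<in> S \<and> (\<lambda>y. y - f x0) ` f ` S \<inter> ((*\<^sub>R) (- \<epsilon>) ` H + uminus ` D) = {}"

definition S_gamma ::
    "'y::real_vector set \<Rightarrow> 'y set \<Rightarrow> ('x::metric_space \<Rightarrow> 'y) \<Rightarrow> 'x set \<Rightarrow> real \<Rightarrow> 'x \<Rightarrow> 'x set"
  where "S_gamma D H f S \<gamma> x = {z \<in> S. f x \<in> f z +o (*\<^sub>R) (\<gamma> * dist x z) ` H + D}"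

text \<open>Dynamical closedness of the value \<open>F x\<close> depends on the whole set-valued map \<open>F\<close>
  and on the point \<open>x\<close>, not only on the set \<open>F x\<close>.\<close>

definition dynamically_closed :: "('x::metric_space \<Rightarrow> 'x set) \<Rightarrow> 'x \<Rightarrow> bool"
  where "dynamically_closed F x \<longleftrightarrow>
    (\<forall>(u :: nat \<Rightarrow> 'x) l.
      (\<forall>n. u n \<in> F x) \<and> (\<forall>n. F (u (Suc n)) \<subseteq> F (u n) \<and> F (u n) \<subseteq> F x) \<and> u \<longlonglongrightarrow> l
      \<longrightarrow> l \<in> F x)"

end

theory Submission
  imports Defs
begin

text \<open>
  This is Ekeland's variational principle, with the real-valued objective replaced by a
  scalarization of the vector-valued one.

  For a displacement \<open>y\<close> let its gain be the supremum of the \<open>t \<ge> 0\<close> for which \<open>y\<close>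
  dominates a point of \<open>t H\<close>, that is \<open>y \<in> t H + D\<close>. Convexity of \<open>H + D\<close> turns the sum of
  \<open>s H + D\<close> and \<open>t H + D\<close> into a part of \<open>(s + t) H + D\<close>. This has two effects:
  \<open>x \<mapsto> S\<^sub>\<gamma>(x)\<close> is a preorder, and along that preorder the gain of \<open>f x0 - f z\<close> grows at least
  by \<open>\<gamma>\<close> times the distance travelled. Efficiency of \<open>x0\<close> says that \<open>f x0 - f z\<close> never lies in
  \<open>\<epsilon> H + D\<close>, and \<open>t H + D\<close> shrinks as \<open>t\<close> grows, so these gains are at most \<open>\<epsilon>\<close>. Thus the gain
  is a bounded Lyapunov function, and walking greedily through sets \<open>S\<^sub>\<gamma>(x\<^sub>n)\<close> whose diameters
  shrink to zero leads to a limit \<open>xhat\<close> (\<open>dynamic_ekeland\<close>). Dynamical closedness keeps the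
  limit in every \<open>S\<^sub>\<gamma>(x\<^sub>n)\<close>, whence \<open>S\<^sub>\<gamma>(xhat) = {xhat}\<close>; this is the third conclusion, and
  \<open>xhat \<in> S\<^sub>\<gamma>(x0)\<close> is the first.

  For the second conclusion, write \<open>f x0 - f xhat = \<gamma> d h + k\<close> with \<open>h \<in> H\<close>, \<open>k \<in> D\<close>,
  \<open>d = dist x0 xhat\<close>. The point \<open>(\<gamma> d / \<epsilon>) h\<close> lies in the cone generated by \<open>H + D\<close>. Were it in
  \<open>H + D\<close> itself, then \<open>f x0 - f xhat\<close> would lie in \<open>\<epsilon> H + D\<close>, against efficiency.
\<close>

section \<open>Ekeland's principle for dynamically closed preorders\<close>

text \<open>
  The principle for an arbitrary preorder given by its lower sets \<open>F x\<close>, with a Lyapunov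
  function \<open>g\<close>. Maximizing \<open>g\<close> over \<open>F (u n)\<close> up to \<open>1 / (n + 1)\<close> leaves, from the next iterate
  on, no room to move further than \<open>1 / (\<gamma> (n + 1))\<close>.
\<close>

lemma dynamic_ekeland:
  fixes F :: "'x::complete_space \<Rightarrow> 'x set" and g :: "'x \<Rightarrow> real"
  assumes refl: "\<And>x. x \<in> F x0 \<Longrightarrow> x \<in> F x" and "x0 \<in> F x0"
    and trans: "\<And>x z. z \<in> F x \<Longrightarrow> F z \<subseteq> F x"
    and closed: "\<And>x. x \<in> F x0 \<Longrightarrow> dynamically_closed F x"
    and bdd: "bdd_above (g ` F x0)"
    and "\<gamma> > 0"
    and grow: "\<And>x z. x \<in> F x0 \<Longrightarrow> z \<in> F x \<Longrightarrow> g x + \<gamma> * dist x z \<le> g z"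
  obtains xhat where "xhat \<in> F x0" "F xhat = {xhat}"
proof -
  have greedy: "\<exists>x'. x' \<in> F x0 \<and> x' \<in> F x \<and> (\<forall>z\<in>F x. g z \<le> g x' + 1 / real (Suc n))"
    if "x \<in> F x0" for x n
  proof -
    have sub: "F x \<subseteq> F x0"
      using trans that by blast
    have bd: "bdd_above (g ` F x)" and ne: "g ` F x \<noteq> {}"
      using bdd_above_mono[OF bdd image_mono[OF sub]] refl[OF that] by auto
    have "Sup (g ` F x) - 1 / real (Suc n) < Sup (g ` F x)"
      by simp
    then obtain x' where x': "x' \<in> F x" "Sup (g ` F x) - 1 / real (Suc n) < g x'"
      using less_cSup_iff[OF ne bd] by auto
    moreover have "g z \<le> g x' + 1 / real (Suc n)" if "z \<in> F x" for z
      using cSup_upper[OF imageI[OF that] bd] x'(2) by linarith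
    ultimately show ?thesis
      using sub by blast
  qed
  have "\<exists>u. \<forall>n. u n \<in> F x0 \<and>
      (u (Suc n) \<in> F (u n) \<and> (\<forall>z\<in>F (u n). g z \<le> g (u (Suc n)) + 1 / real (Suc n)))"
    by (rule dependent_nat_choice) (use \<open>x0 \<in> F x0\<close> greedy in blast)+
  then obtain u where u0: "\<And>n. u n \<in> F x0" and step: "\<And>n. u (Suc n) \<in> F (u n)"
    and near_max: "\<And>n z. z \<in> F (u n) \<Longrightarrow> g z \<le> g (u (Suc n)) + 1 / real (Suc n)"
    by blast
  have "F (u (Suc n)) \<subseteq> F (u n)" for n
    using trans step by blast
  then have nested: "F (u m) \<subseteq> F (u n)" if "n \<le> m" for m n
    by (rule lift_Suc_antimono_le[of "\<lambda>n. F (u n)", OF _ that])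
  have close: "dist (u (Suc n)) z \<le> 1 / real (Suc n) / \<gamma>" if "z \<in> F (u (Suc n))" for n z
  proof -
    have "g z \<le> g (u (Suc n)) + 1 / real (Suc n)"
      using near_max nested[of n "Suc n"] that by auto
    moreover have "g (u (Suc n)) + \<gamma> * dist (u (Suc n)) z \<le> g z"
      using grow u0 that by blast
    ultimately have "dist (u (Suc n)) z * \<gamma> \<le> 1 / real (Suc n)"
      unfolding mult.commute[of _ \<gamma>] by linarith
    then show ?thesis
      by (simp only: pos_le_divide_eq[OF \<open>\<gamma> > 0\<close>])
  qed
  have radius: "(\<lambda>n. 1 / real (Suc n) / \<gamma>) \<longlonglongrightarrow> 0"
    using tendsto_divide[OF LIMSEQ_inverse_real_of_nat tendsto_const[of \<gamma>]] \<open>\<gamma> > 0\<close>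
    by (simp add: inverse_eq_divide)
  have tail: "u m \<in> F (u n)" if "n \<le> m" for m n
    using nested[OF that] refl[OF u0] by blast
  have "Cauchy u"
  proof (rule metric_CauchyI)
    fix e :: real
    assume "e > 0"
    then have "eventually (\<lambda>n. 1 / real (Suc n) / \<gamma> < e / 2) sequentially"
      using order_tendstoD(2)[OF radius, of "e / 2"] by simp
    then obtain n where n: "1 / real (Suc n) / \<gamma> < e / 2"
      using eventually_happens'[OF sequentially_bot] by blast
    have "dist (u i) (u j) < e" if "i \<ge> Suc n" "j \<ge> Suc n" for i j
      using close[OF tail[OF that(1)]] close[OF tail[OF that(2)]] n
        dist_triangle3[of "u i" "u j" "u (Suc n)"] by linarith
    then show "\<exists>M. \<forall>m\<ge>M. \<forall>n\<ge>M. dist (u m) (u n) < e"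
      by blast
  qed
  then obtain xhat where lim: "u \<longlonglongrightarrow> xhat"
    using Cauchy_convergent convergentD by blast
  \<comment> \<open>Dynamical closedness at \<open>u n\<close> is applied to the tail of \<open>u\<close> that starts at \<open>u n\<close>.\<close>
  have in_all: "xhat \<in> F (u n)" for n
  proof -
    have "(\<lambda>k. u (k + n)) \<longlonglongrightarrow> xhat"
      using lim by (rule LIMSEQ_ignore_initial_segment)
    then show ?thesis
      using closed[OF u0[of n], unfolded dynamically_closed_def,
          rule_format, of "\<lambda>k. u (k + n)" xhat]
      by (simp add: tail nested)
  qed
  have "xhat \<in> F x0"
    using in_all trans u0 by blast
  moreover have "x = xhat" if "x \<in> F xhat" for x
  proof -
    have "x \<in> F (u n)" for n
      using in_all trans that by blast
    then have "(\<lambda>n. dist (u (Suc n)) x) \<longlonglongrightarrow> 0"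
      using close by (intro tendsto_sandwich[OF _ _ tendsto_const radius]) auto
    then have "(\<lambda>n. u (Suc n)) \<longlonglongrightarrow> x"
      using tendsto_dist_iff by blast
    then show ?thesis
      using LIMSEQ_Suc[OF lim] LIMSEQ_unique by blast
  qed
  ultimately show ?thesis
    using that refl by blast
qed

section \<open>Arithmetic of the sets \<open>t H + D\<close>\<close>

lemma mem_dilation_iff:
  fixes D H :: "'y::real_vector set"
  shows "y \<in> (*\<^sub>R) t ` H + D \<longleftrightarrow> (\<exists>h\<in>H. \<exists>k\<in>D. y = t *\<^sub>R h + k)"
  by (auto simp: set_plus_def)

text \<open>Since \<open>H \<subseteq> D\<close>, the surplus \<open>(t - s) h\<close> can be moved into \<open>D\<close>.\<close>

lemma dilation_antimono:
  fixes D H :: "'y::real_vector set"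
  assumes D: "convex_cone D" and "H \<subseteq> D" and "s \<le> t"
  shows "(*\<^sub>R) t ` H + D \<subseteq> (*\<^sub>R) s ` H + D"
proof
  fix y
  assume "y \<in> (*\<^sub>R) t ` H + D"
  then obtain h k where hk: "h \<in> H" "k \<in> D" "y = t *\<^sub>R h + k"
    by (auto simp: mem_dilation_iff)
  have "(t - s) *\<^sub>R h + k \<in> D"
    using hk assms by (intro convex_cone_add convex_cone_scaleR) auto
  moreover have "y = s *\<^sub>R h + ((t - s) *\<^sub>R h + k)"
    using hk(3) by (simp add: algebra_simps)
  ultimately show "y \<in> (*\<^sub>R) s ` H + D"
    using hk(1) mem_dilation_iff by blast
qed

text \<open>
  For \<open>s + t > 0\<close> the weights \<open>s / (s + t)\<close> and \<open>t / (s + t)\<close> merge the two points of \<open>H\<close>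
  into one point of the convex set \<open>H + D\<close>. It is \<open>H + D\<close> and not \<open>H\<close> that is convex, so the
  merged point has its own remainder in \<open>D\<close>.
\<close>

lemma dilation_add:
  fixes D H :: "'y::real_vector set"
  assumes D: "convex_cone D" and "D_convex D H" and "0 \<le> s" and "0 \<le> t"
    and x: "x \<in> (*\<^sub>R) s ` H + D" and y: "y \<in> (*\<^sub>R) t ` H + D"
  shows "x + y \<in> (*\<^sub>R) (s + t) ` H + D"
proof -
  obtain h k where hk: "h \<in> H" "k \<in> D" "x = s *\<^sub>R h + k"
    using x by (auto simp: mem_dilation_iff)
  obtain h' k' where hk': "h' \<in> H" "k' \<in> D" "y = t *\<^sub>R h' + k'"
    using y by (auto simp: mem_dilation_iff)
  have kk': "k + k' \<in> D"
    using D hk hk' by (simp add: convex_cone_add)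
  show ?thesis
  proof (cases "s + t = 0")
    case True
    then have "s = 0" "t = 0"
      using \<open>0 \<le> s\<close> \<open>0 \<le> t\<close> by auto
    then have "x + y = (s + t) *\<^sub>R h + (k + k')"
      using hk hk' by simp
    then show ?thesis
      using hk(1) kk' mem_dilation_iff by blast
  next
    case False
    then have pos: "s + t > 0"
      using \<open>0 \<le> s\<close> \<open>0 \<le> t\<close> by linarith
    have "0 \<in> D"
      using D by (simp add: convex_cone_contains_0)
    then have "h \<in> H + D" "h' \<in> H + D"
      using hk(1) hk'(1) set_plus_intro[of _ H 0 D] by force+
    moreover have "convex (H + D)"
      using \<open>D_convex D H\<close> by (simp add: D_convex_def)
    ultimately have "(s / (s + t)) *\<^sub>R h + (t / (s + t)) *\<^sub>R h' \<in> H + D"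
      using pos \<open>0 \<le> s\<close> \<open>0 \<le> t\<close> by (intro convexD) (auto simp: add_divide_distrib[symmetric])
    then obtain p q where pq: "p \<in> H" "q \<in> D"
      "(s / (s + t)) *\<^sub>R h + (t / (s + t)) *\<^sub>R h' = p + q"
      by (auto elim: set_plus_elim)
    have "s *\<^sub>R h + t *\<^sub>R h' = (s + t) *\<^sub>R ((s / (s + t)) *\<^sub>R h + (t / (s + t)) *\<^sub>R h')"
      using pos by (simp add: scaleR_add_right)
    also have "\<dots> = (s + t) *\<^sub>R p + (s + t) *\<^sub>R q"
      by (simp add: pq(3) scaleR_add_right)
    finally have "x + y = (s + t) *\<^sub>R p + ((s + t) *\<^sub>R q + (k + k'))"
      using hk(3) hk'(3) by (simp add: algebra_simps)
    moreover have "(s + t) *\<^sub>R q + (k + k') \<in> D"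
      using D pq(2) pos by (intro convex_cone_add[OF D _ kk'] convex_cone_scaleR) auto
    ultimately show ?thesis
      using pq(1) mem_dilation_iff by blast
  qed
qed

section \<open>Scalarization\<close>

text \<open>
  When \<open>H\<close> is a single vector, this is, up to signs and the restriction to \<open>t \<ge> 0\<close>, the
  Gerstewitz scalarization functional of the cone \<open>D\<close>.
\<close>

definition gain :: "'y::real_vector set \<Rightarrow> 'y set \<Rightarrow> 'y \<Rightarrow> real"
  where "gain D H y = Sup {t. 0 \<le> t \<and> y \<in> (*\<^sub>R) t ` H + D}"

lemma dilation_factor_le:
  assumes "convex_cone D" "H \<subseteq> D" "y \<notin> (*\<^sub>R) \<epsilon> ` H + D"
    and "t \<in> {t. 0 \<le> t \<and> y \<in> (*\<^sub>R) t ` H + D}"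
  shows "t \<le> \<epsilon>"
  using dilation_antimono[OF assms(1,2), of \<epsilon> t] assms(3,4) by force

text \<open>
  The hypothesis that \<open>y + p\<close> stays outside \<open>\<epsilon> H + D\<close> makes the suprema finite, and
  \<open>y \<in> s H + D\<close> makes the first one a supremum over a nonempty set.
\<close>

lemma gain_add:
  assumes "convex_cone D" "H \<subseteq> D" "D_convex D H"
    and "0 \<le> s" "y \<in> (*\<^sub>R) s ` H + D" and "0 \<le> t" "p \<in> (*\<^sub>R) t ` H + D"
    and "y + p \<notin> (*\<^sub>R) \<epsilon> ` H + D"
  shows "gain D H y + t \<le> gain D H (y + p)"
proof -
  have bdd: "bdd_above {r. 0 \<le> r \<and> y + p \<in> (*\<^sub>R) r ` H + D}"
    using dilation_factor_le[OF assms(1,2,8)] by (rule bdd_aboveI)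
  have "gain D H y \<le> gain D H (y + p) - t"
    unfolding gain_def
  proof (rule cSup_least)
    show "{r. 0 \<le> r \<and> y \<in> (*\<^sub>R) r ` H + D} \<noteq> {}"
      using assms(4,5) by blast
  next
    fix r
    assume "r \<in> {r. 0 \<le> r \<and> y \<in> (*\<^sub>R) r ` H + D}"
    then have "r + t \<in> {r. 0 \<le> r \<and> y + p \<in> (*\<^sub>R) r ` H + D}"
      using assms dilation_add[of D H r t y p] by auto
    from cSup_upper[OF this bdd]
    show "r \<le> Sup {r. 0 \<le> r \<and> y + p \<in> (*\<^sub>R) r ` H + D} - t"
      by linarith
  qed
  then show ?thesis
    by linarith
qed

section \<open>Efficiency and the preorder given by \<open>S\<^sub>\<gamma>\<close>\<close>

lemma nemeth_efficient_iff:
  "nemeth_efficient D H \<epsilon> f S x0 \<longleftrightarrow>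
    x0 \<in> S \<and> (\<forall>z\<in>S. f x0 - f z \<notin> (*\<^sub>R) \<epsilon> ` H + D)"
proof -
  have "y \<in> (*\<^sub>R) \<epsilon> ` H + D \<longleftrightarrow> - y \<in> (*\<^sub>R) (- \<epsilon>) ` H + uminus ` D" for y
  proof -
    have "(y = \<epsilon> *\<^sub>R h + k) = (- y = (- \<epsilon>) *\<^sub>R h + - k)" for h k
      by (metis minus_add_distrib neg_equal_iff_equal scaleR_minus_left)
    then show ?thesis
      unfolding set_plus_def by blast
  qed
  from this[of "f x0 - f z" for z] show ?thesis
    by (auto simp: nemeth_efficient_def)
qed

lemma mem_S_gamma_iff:
  "z \<in> S_gamma D H f S \<gamma> x \<longleftrightarrow> z \<in> S \<and> f x - f z \<in> (*\<^sub>R) (\<gamma> * dist x z) ` H + D"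
proof -
  have "f z +o (*\<^sub>R) t ` H + D = f z +o ((*\<^sub>R) t ` H + D)" for t
    by (simp add: set_plus_rearrange3)
  then show ?thesis
    by (simp add: S_gamma_def set_minus_plus)
qed

lemma S_gamma_refl:
  assumes "convex_cone D" "H \<noteq> {}" "x \<in> S"
  shows "x \<in> S_gamma D H f S \<gamma> x"
  using assms by (auto simp: mem_S_gamma_iff mem_dilation_iff[of _ 0, simplified]
      convex_cone_contains_0)

text \<open>
  The two displacements add up, and the triangle inequality only helps because dilations
  shrink as the factor grows.
\<close>

lemma S_gamma_trans:
  assumes "convex_cone D" "H \<subseteq> D" "D_convex D H" "0 \<le> \<gamma>"
    and z: "z \<in> S_gamma D H f S \<gamma> x"
  shows "S_gamma D H f S \<gamma> z \<subseteq> S_gamma D H f S \<gamma> x"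
proof
  fix w
  assume w: "w \<in> S_gamma D H f S \<gamma> z"
  have "(f x - f z) + (f z - f w) \<in> (*\<^sub>R) (\<gamma> * dist x z + \<gamma> * dist z w) ` H + D"
    using z w assms by (intro dilation_add) (auto simp: mem_S_gamma_iff)
  moreover have "\<gamma> * dist x w \<le> \<gamma> * dist x z + \<gamma> * dist z w"
    using \<open>0 \<le> \<gamma>\<close> dist_triangle[of x w z]
    by (metis distrib_left mult_left_mono)
  ultimately have "f x - f w \<in> (*\<^sub>R) (\<gamma> * dist x w) ` H + D"
    using dilation_antimono[OF assms(1,2)] by force
  then show "w \<in> S_gamma D H f S \<gamma> x"
    using w by (simp add: mem_S_gamma_iff)
qed

section \<open>Existence of an efficient point near \<open>x0\<close>\<close>

theorem theorem4p1:
  fixes S :: "'x::complete_space set"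
    and D H :: "'y::real_vector set"
    and f :: "'x \<Rightarrow> 'y"
    and x0 :: 'x
    and \<epsilon> \<gamma> :: real
  assumes "S \<noteq> {}" and "closed S"
    and "convex_cone D"
    and "H \<noteq> {}" and "H \<subseteq> D" and "D_convex D H"
    and "0 \<notin> vcl (H + D)"
    and "\<epsilon> > 0" and "x0 \<in> S" and "nemeth_efficient D H \<epsilon> f S x0"
    and "\<gamma> > 0"
    and "\<forall>x \<in> S_gamma D H f S \<gamma> x0. dynamically_closed (S_gamma D H f S \<gamma>) x"
  shows "\<exists>xhat \<in> S.
      f x0 \<in> f xhat +o (*\<^sub>R) (\<gamma> * dist x0 xhat) ` H + D \<and>
      (*\<^sub>R) (dist x0 xhat) ` H \<inter> (*\<^sub>R) (\<epsilon> / \<gamma>) ` (conic hull (H + D) - (H + D)) \<noteq> {} \<and>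
      (\<forall>x \<in> S - {xhat}. f xhat \<notin> f x +o (*\<^sub>R) (\<gamma> * dist xhat x) ` H + D)"
proof -
  let ?F = "S_gamma D H f S \<gamma>"
  let ?g = "\<lambda>z. gain D H (f x0 - f z)"
  note D = \<open>convex_cone D\<close> and HD = \<open>H \<subseteq> D\<close> and conv = \<open>D_convex D H\<close>
  have eff: "f x0 - f z \<notin> (*\<^sub>R) \<epsilon> ` H + D" if "z \<in> S" for z
    using \<open>nemeth_efficient D H \<epsilon> f S x0\<close> that by (simp add: nemeth_efficient_iff)
  have inS: "z \<in> S" if "z \<in> ?F x" for x z
    using that by (simp add: mem_S_gamma_iff)
  have bdd: "bdd_above (?g ` ?F x0)"
  proof (rule bdd_aboveI2)
    fix z
    assume z: "z \<in> ?F x0"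
    then have "\<gamma> * dist x0 z \<in> {t. 0 \<le> t \<and> f x0 - f z \<in> (*\<^sub>R) t ` H + D}"
      using \<open>\<gamma> > 0\<close> by (simp add: mem_S_gamma_iff)
    then show "?g z \<le> \<epsilon>"
      unfolding gain_def using dilation_factor_le[OF D HD eff[OF inS[OF z]]]
      by (intro cSup_least) blast+
  qed
  have grow: "?g x + \<gamma> * dist x z \<le> ?g z" if x: "x \<in> ?F x0" and z: "z \<in> ?F x" for x z
    using gain_add[OF D HD conv, of "\<gamma> * dist x0 x" "f x0 - f x" "\<gamma> * dist x z" "f x - f z" \<epsilon>]
      x z eff[OF inS[OF z]] \<open>\<gamma> > 0\<close>
    by (simp add: mem_S_gamma_iff)
  obtain xhat where xhat: "xhat \<in> ?F x0" "?F xhat = {xhat}"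
  proof (rule dynamic_ekeland[of ?F x0 ?g \<gamma>])
    show "x \<in> ?F x" if "x \<in> ?F x0" for x
      using S_gamma_refl[OF D \<open>H \<noteq> {}\<close> inS[OF that]] .
    show "x0 \<in> ?F x0"
      using S_gamma_refl[OF D \<open>H \<noteq> {}\<close> \<open>x0 \<in> S\<close>] .
    show "?F z \<subseteq> ?F x" if "z \<in> ?F x" for x z
      using S_gamma_trans[OF D HD conv _ that] \<open>\<gamma> > 0\<close> by simp
    show "dynamically_closed ?F x" if "x \<in> ?F x0" for x
      using assms(12) that by blast
  qed (use bdd grow \<open>\<gamma> > 0\<close> in blast)+
  let ?d = "dist x0 xhat"
  obtain h k where hk: "h \<in> H" "k \<in> D" "f x0 - f xhat = (\<gamma> * ?d) *\<^sub>R h + k"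
    using xhat(1) by (auto simp: mem_S_gamma_iff mem_dilation_iff)
  \<comment> \<open>The factor is forced by \<open>?d *\<^sub>R h = (\<epsilon> / \<gamma>) *\<^sub>R y\<close>.\<close>
  define y where "y = (\<gamma> * ?d / \<epsilon>) *\<^sub>R h"
  have "0 \<in> D"
    using D by (simp add: convex_cone_contains_0)
  then have "h \<in> H + D"
    using hk(1) set_plus_intro[of h H 0 D] by simp
  then have "y \<in> conic hull (H + D)"
    unfolding y_def conic_hull_explicit using \<open>\<gamma> > 0\<close> \<open>\<epsilon> > 0\<close> by force
  moreover have "y \<notin> H + D"
  proof
    assume "y \<in> H + D"
    then obtain p q where pq: "p \<in> H" "q \<in> D" "y = p + q"
      by (auto elim: set_plus_elim)
    have "(\<gamma> * ?d) *\<^sub>R h = \<epsilon> *\<^sub>R y"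
      using \<open>\<epsilon> > 0\<close> by (simp add: y_def)
    then have "f x0 - f xhat = \<epsilon> *\<^sub>R p + (\<epsilon> *\<^sub>R q + k)"
      using hk(3) pq(3) by (simp add: algebra_simps)
    moreover have "\<epsilon> *\<^sub>R q + k \<in> D"
      using D pq(2) hk(2) \<open>\<epsilon> > 0\<close> by (intro convex_cone_add convex_cone_scaleR) auto
    ultimately show False
      using eff[OF inS[OF xhat(1)]] pq(1) mem_dilation_iff by blast
  qed
  moreover have "?d *\<^sub>R h = (\<epsilon> / \<gamma>) *\<^sub>R y"
    using \<open>\<gamma> > 0\<close> \<open>\<epsilon> > 0\<close> by (simp add: y_def)
  ultimately have "?d *\<^sub>R h \<in> (*\<^sub>R) ?d ` H \<inter> (*\<^sub>R) (\<epsilon> / \<gamma>) ` (conic hull (H + D) - (H + D))"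
    using hk(1) by blast
  then have b: "(*\<^sub>R) ?d ` H \<inter> (*\<^sub>R) (\<epsilon> / \<gamma>) ` (conic hull (H + D) - (H + D)) \<noteq> {}"
    by blast
  show ?thesis
  proof (intro bexI conjI ballI)
    show "(*\<^sub>R) ?d ` H \<inter> (*\<^sub>R) (\<epsilon> / \<gamma>) ` (conic hull (H + D) - (H + D)) \<noteq> {}"
      using b .
    show "xhat \<in> S"
      using inS xhat(1) .
    show "f x0 \<in> f xhat +o (*\<^sub>R) (\<gamma> * ?d) ` H + D"
      using xhat(1) by (simp add: S_gamma_def)
    show "f xhat \<notin> f x +o (*\<^sub>R) (\<gamma> * dist xhat x) ` H + D" if "x \<in> S - {xhat}" for x
      using xhat(2) that by (auto simp: S_gamma_def)
  qed
qed

end
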